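(* Let $G$ be a finitely generated group and $K$ a finite subgroup of $G$. Then $(G,K)$ is context-free if and only if $G$ is a context-free (i.e. virtually free) group.
   Context: A *semigroup presentation* of a finitely generated group $G$ is a (not necessarily injective) map $\psi:\Sigma\to G$ from a finite alphabet $\Sigma$ such that its extension to a monoid homomorphism $\psi:\Sigma^*\to G$ is surjective. For a subgroup $K\le G$, $L(G,K,\psi)=\{w\in\Sigma^*:\psi(w)\in K\}$. The pair $(G,K)$ is *context-free* if $L(G,K,\psi)$ is a context-free language for some (equivalently, every) semigroup presentation $\psi$ of $G$. The group $G$ is *context-free* if the pair $(G,\{1_G\})$ is context-free; by a known theorem (Muller–Schupp, with Dunwoody) a finitely generated group is context-free if and only if it is virtually free, i.e. contains a free subgroup of finite index. *)

theory Defs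
  imports "HOL-Algebra.Generated_Groups"
begin

section \<open>Context-free languages\<close>

datatype ('n, 't) sym = Nt 'n | Tm 't

type_synonym ('n, 't) prods = "('n \<times> ('n, 't) sym list) set"

inductive derivation_step :: "('n, 't) prods \<Rightarrow> ('n, 't) sym list \<Rightarrow> ('n, 't) sym list \<Rightarrow> bool"
  for P where
  "(A, \<alpha>) \<in> P \<Longrightarrow> derivation_step P (u @ [Nt A] @ v) (u @ \<alpha> @ v)"

definition grammar_lang :: "('n, 't) prods \<Rightarrow> 'n \<Rightarrow> 't list set" where
  "grammar_lang P S = {w. (derivation_step P)\<^sup>*\<^sup>* [Nt S] (map Tm w)}"

text \<open>
  Nonterminals are drawn from \<^typ>\<open>nat\<close>. This loses nothing: a finite set of productions mentions
  only finitely many nonterminals, and these can be renamed.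
\<close>

definition context_free_lang :: "'t list set \<Rightarrow> bool" where
  "context_free_lang L \<longleftrightarrow>
     (\<exists>(P :: (nat, 't) prods) S. finite P \<and> L = grammar_lang P S)"

section \<open>Semigroup presentations and context-free pairs\<close>

definition finitely_generated :: "('g, 'm) monoid_scheme \<Rightarrow> bool" where
  "finitely_generated G \<longleftrightarrow>
     (\<exists>X. finite X \<and> X \<subseteq> carrier G \<and> generate G X = carrier G)"

definition word_value :: "('g, 'm) monoid_scheme \<Rightarrow> ('s \<Rightarrow> 'g) \<Rightarrow> 's list \<Rightarrow> 'g" where
  "word_value G \<psi> w = foldr (\<lambda>s g. \<psi> s \<otimes>\<^bsub>G\<^esub> g) w \<one>\<^bsub>G\<^esub>"

definition semigroup_presentation ::
  "('g, 'm) monoid_scheme \<Rightarrow> 's set \<Rightarrow> ('s \<Rightarrow> 'g) \<Rightarrow> bool" where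
  "semigroup_presentation G \<Sigma> \<psi> \<longleftrightarrow>
     finite \<Sigma> \<and> \<psi> \<in> \<Sigma> \<rightarrow> carrier G \<and> word_value G \<psi> ` lists \<Sigma> = carrier G"

definition subgroup_lang ::
  "('g, 'm) monoid_scheme \<Rightarrow> 'g set \<Rightarrow> 's set \<Rightarrow> ('s \<Rightarrow> 'g) \<Rightarrow> 's list set" where
  "subgroup_lang G K \<Sigma> \<psi> = {w \<in> lists \<Sigma>. word_value G \<psi> w \<in> K}"

text \<open>
  HOL cannot quantify over the type of letters here, so the alphabet is a finite set of natural
  numbers; every finite alphabet is in bijection with one. The map \<open>\<psi>\<close> need not be injective.
\<close>

definition context_free_pair :: "('g, 'm) monoid_scheme \<Rightarrow> 'g set \<Rightarrow> bool" where
  "context_free_pair G K \<longleftrightarrow>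
     (\<exists>(\<Sigma> :: nat set) \<psi>. semigroup_presentation G \<Sigma> \<psi> \<and>
        context_free_lang (subgroup_lang G K \<Sigma> \<psi>))"

definition context_free_group :: "('g, 'm) monoid_scheme \<Rightarrow> bool" where
  "context_free_group G \<longleftrightarrow> context_free_pair G {\<one>\<^bsub>G\<^esub>}"

end

theory Submission
  imports Defs "HOL-Library.Sublist"
begin

text \<open>
  If a nonterminal \<open>A\<close> occurs in a derivation \<open>S \<Rightarrow>\<^sup>* p A q\<close> of a grammar for \<open>L(G,K)\<close>,
  with \<open>p\<close> and \<open>q\<close> terminal words, then every word derived from \<open>A\<close> has its value in
  \<open>\<psi>(p)\<inverse> K \<psi>(q)\<inverse>\<close>, which is finite because \<open>K\<close> is. So the nonterminals can be
  annotated by the values of the words that they produce, and the start symbol annotated by \<open>1\<close>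
  generates \<open>L(G,1)\<close>. Conversely, if \<open>U\<close> is a finite set of words whose values make up \<open>K\<close>, then
  \<open>L(G,K)\<close> is the left quotient \<open>{w. \<exists>u\<in>U. uw \<in> L(G,1)}\<close>. It is context-free, again by
  annotating nonterminals, this time by the part of \<open>u\<close> that has to be cut off.
\<close>

section \<open>Big-step derivations\<close>

text \<open>Derivation forests: a sequence of steps interleaves the nonterminals, whereas rule
  induction here gives each nonterminal its own factor of the word.\<close>

inductive yields :: "('n, 't) prods \<Rightarrow> ('n, 't) sym list \<Rightarrow> 't list \<Rightarrow> bool" for P where
  yields_Nil: "yields P [] []"
| yields_Tm: "yields P \<alpha> w \<Longrightarrow> yields P (Tm a # \<alpha>) (a # w)"
| yields_Nt: "(A, \<beta>) \<in> P \<Longrightarrow> yields P \<beta> u \<Longrightarrow> yields P \<alpha> v \<Longrightarrow> yields P (Nt A # \<alpha>) (u @ v)"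

inductive_cases yields_NilE: "yields P [] w"
inductive_cases yields_TmE: "yields P (Tm a # \<alpha>) w"
inductive_cases yields_NtE: "yields P (Nt A # \<alpha>) w"

lemma yields_append: "yields P \<alpha> u \<Longrightarrow> yields P \<beta> v \<Longrightarrow> yields P (\<alpha> @ \<beta>) (u @ v)"
  by (induction rule: yields.induct) (auto intro: yields.intros)

lemma yields_appendE:
  assumes "yields P (\<alpha> @ \<beta>) w"
  obtains u v where "w = u @ v" "yields P \<alpha> u" "yields P \<beta> v"
  using assms
proof (induction \<alpha> arbitrary: w thesis)
  case Nil
  then show ?case by (metis append_Nil yields_Nil)
next
  case (Cons x \<alpha>)
  show ?case
  proof (cases x)
    case (Nt A)
    with Cons.prems(2) obtain \<gamma> u v where
      *: "(A, \<gamma>) \<in> P" "yields P \<gamma> u" "yields P (\<alpha> @ \<beta>) v" "w = u @ v"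
      by (auto elim: yields_NtE)
    obtain v1 v2 where "v = v1 @ v2" "yields P \<alpha> v1" "yields P \<beta> v2"
      using Cons.IH *(3) by blast
    with * show ?thesis
      by (intro Cons.prems(1)[of "u @ v1" v2]) (auto simp: Nt intro: yields_Nt)
  next
    case (Tm a)
    with Cons.prems(2) obtain v where *: "yields P (\<alpha> @ \<beta>) v" "w = a # v"
      by (auto elim: yields_TmE)
    obtain v1 v2 where "v = v1 @ v2" "yields P \<alpha> v1" "yields P \<beta> v2"
      using Cons.IH *(1) by blast
    with * show ?thesis
      by (intro Cons.prems(1)[of "a # v1" v2]) (auto simp: Tm intro: yields_Tm)
  qed
qed

lemma yields_terminals: "yields P (map Tm w) w"
  by (induction w) (auto intro: yields.intros)

lemma yields_single_Nt_iff: "yields P [Nt A] w \<longleftrightarrow> (\<exists>\<beta>. (A, \<beta>) \<in> P \<and> yields P \<beta> w)"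
proof
  show "yields P [Nt A] w \<Longrightarrow> \<exists>\<beta>. (A, \<beta>) \<in> P \<and> yields P \<beta> w"
    by (auto elim!: yields_NtE yields_NilE)
  show "\<exists>\<beta>. (A, \<beta>) \<in> P \<and> yields P \<beta> w \<Longrightarrow> yields P [Nt A] w"
    using yields_Nt[OF _ _ yields_Nil] by fastforce
qed

lemma derivation_step_context:
  assumes "derivation_step P \<alpha> \<beta>"
  shows "derivation_step P (x @ \<alpha> @ y) (x @ \<beta> @ y)"
  using assms
proof cases
  case (1 A \<gamma> u v)
  then show ?thesis
    using derivation_step.intros[of A \<gamma> P "x @ u" "v @ y"] by simp
qed

lemma derivation_context:
  assumes "(derivation_step P)\<^sup>*\<^sup>* \<alpha> \<beta>"
  shows "(derivation_step P)\<^sup>*\<^sup>* (x @ \<alpha> @ y) (x @ \<beta> @ y)"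
  using assms
  by (induction rule: rtranclp_induct)
    (auto intro: rtranclp.rtrancl_into_rtrancl derivation_step_context)

text \<open>Forwards, undoing the first step puts a tree with root \<open>A\<close> over the factor
  produced by \<open>\<beta>\<close>. Backwards, the forest is expanded leftmost nonterminal
  first.\<close>

lemma derivation_iff_yields: "(derivation_step P)\<^sup>*\<^sup>* \<alpha> (map Tm w) \<longleftrightarrow> yields P \<alpha> w"
proof
  assume "(derivation_step P)\<^sup>*\<^sup>* \<alpha> (map Tm w)"
  then show "yields P \<alpha> w"
  proof (induction rule: converse_rtranclp_induct)
    case base
    show ?case by (rule yields_terminals)
  next
    case (step \<gamma> \<delta>)
    from step.hyps(1) obtain A \<beta> u v where
      *: "(A, \<beta>) \<in> P" "\<gamma> = u @ [Nt A] @ v" "\<delta> = u @ \<beta> @ v"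
      by (auto elim: derivation_step.cases)
    with step.IH obtain w1 w2 w3 where
      "w = w1 @ w2 @ w3" "yields P u w1" "yields P \<beta> w2" "yields P v w3"
      by (metis yields_appendE)
    with * show ?case
      by (auto intro!: yields_append yields_Nt)
  qed
next
  assume "yields P \<alpha> w"
  then show "(derivation_step P)\<^sup>*\<^sup>* \<alpha> (map Tm w)"
  proof (induction rule: yields.induct)
    case yields_Nil
    then show ?case by simp
  next
    case (yields_Tm \<alpha> w a)
    then show ?case using derivation_context[of P \<alpha> "map Tm w" "[Tm a]" "[]"] by simp
  next
    case (yields_Nt A \<beta> u \<alpha> v)
    have "derivation_step P (Nt A # \<alpha>) (\<beta> @ \<alpha>)"
      using derivation_step.intros[OF yields_Nt.hyps(1), of "[]" \<alpha>] by simp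
    moreover have "(derivation_step P)\<^sup>*\<^sup>* (\<beta> @ \<alpha>) (map Tm u @ \<alpha>)"
      using derivation_context[OF yields_Nt.IH(1), of "[]" \<alpha>] by simp
    moreover have "(derivation_step P)\<^sup>*\<^sup>* (map Tm u @ \<alpha>) (map Tm (u @ v))"
      using derivation_context[OF yields_Nt.IH(2), of "map Tm u" "[]"] by simp
    ultimately show ?case
      by (meson converse_rtranclp_into_rtranclp rtranclp_trans)
  qed
qed

lemma grammar_lang_eq_yields: "grammar_lang P S = {w. yields P [Nt S] w}"
  by (simp add: grammar_lang_def derivation_iff_yields)

section \<open>Renaming of nonterminals\<close>

definition rename_prods :: "('n \<Rightarrow> 'm) \<Rightarrow> ('n, 't) prods \<Rightarrow> ('m, 't) prods" where
  "rename_prods f P = (\<lambda>(A, \<alpha>). (f A, map (map_sym f id) \<alpha>)) ` P"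

lemma yields_rename:
  "yields P \<alpha> w \<Longrightarrow> yields (rename_prods f P) (map (map_sym f id) \<alpha>) w"
proof (induction rule: yields.induct)
  case (yields_Nt A \<beta> u \<alpha> v)
  have "(f A, map (map_sym f id) \<beta>) \<in> rename_prods f P"
    using yields_Nt.hyps(1) by (force simp: rename_prods_def)
  then show ?case
    unfolding list.map sym.map by (rule yields.yields_Nt) (rule yields_Nt.IH)+
qed (auto intro: yields.intros)

text \<open>Annotated nonterminals are pairs, whereas \<open>context_free_lang\<close> asks for
  natural numbers. A renaming that is injective on the occurring nonterminals has a left inverse
  there, so \<open>yields_rename\<close> gives both inclusions.\<close>

lemma context_free_lang_grammar_lang:
  fixes P :: "('n, 't) prods"
  assumes "finite P"
  shows "context_free_lang (grammar_lang P S)"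
proof -
  define N where "N = insert S (\<Union>(A, \<alpha>) \<in> P. insert A (\<Union>x \<in> set \<alpha>. set1_sym x))"
  have "finite (set1_sym x)" for x :: "('n, 't) sym"
    by (cases x) auto
  then have "finite N"
    using assms by (auto simp: N_def)
  then obtain f :: "'n \<Rightarrow> nat" where f: "inj_on f N"
    using finite_imp_inj_to_nat_seg by blast
  define g where "g = inv_into N f"
  have gf: "g (f A) = A" if "A \<in> N" for A
    using f that by (simp add: g_def)
  have "map_sym g id (map_sym f id x) = x" if "(A, \<alpha>) \<in> P" "x \<in> set \<alpha>" for A \<alpha> x
  proof (cases x)
    case (Nt B)
    with that have "B \<in> N" by (force simp: N_def)
    then show ?thesis by (simp add: Nt gf)
  qed simp
  then have "map (map_sym g id) (map (map_sym f id) \<alpha>) = \<alpha>" if "(A, \<alpha>) \<in> P" for A \<alpha>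
    using that by (auto intro!: map_idI)
  moreover have "g (f A) = A" if "(A, \<alpha>) \<in> P" for A \<alpha>
    using that by (intro gf) (force simp: N_def)
  ultimately have "(\<lambda>p. case (case p of (A, \<alpha>) \<Rightarrow> (f A, map (map_sym f id) \<alpha>)) of
      (A, \<alpha>) \<Rightarrow> (g A, map (map_sym g id) \<alpha>)) ` P = (\<lambda>p. p) ` P"
    by (intro image_cong) auto
  then have "rename_prods g (rename_prods f P) = P"
    by (simp add: rename_prods_def image_image)
  then have "yields P [Nt S] w \<longleftrightarrow> yields (rename_prods f P) [Nt (f S)] w" for w
    using yields_rename[of P "[Nt S]" w f] yields_rename[of "rename_prods f P" "[Nt (f S)]" w g]
    by (auto simp: gf N_def)
  then have "grammar_lang P S = grammar_lang (rename_prods f P) (f S)"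
    by (simp add: grammar_lang_eq_yields)
  moreover have "finite (rename_prods f P)"
    using assms by (simp add: rename_prods_def)
  ultimately show ?thesis
    by (auto simp: context_free_lang_def)
qed

section \<open>Languages closed under the productions\<close>

fun substituted_lang :: "('n \<Rightarrow> 't list set) \<Rightarrow> ('n, 't) sym list \<Rightarrow> 't list set" where
  "substituted_lang M [] = {[]}"
| "substituted_lang M (Tm a # \<alpha>) = (\<lambda>w. a # w) ` substituted_lang M \<alpha>"
| "substituted_lang M (Nt A # \<alpha>) = {u @ v | u v. u \<in> M A \<and> v \<in> substituted_lang M \<alpha>}"

lemma substituted_lang_terminals_append:
  "substituted_lang M (map Tm z @ \<alpha>) = (\<lambda>w. z @ w) ` substituted_lang M \<alpha>"
  by (induction z) (auto simp: image_image)

text \<open>The second assumption makes \<open>M\<close> a pre-fixed point of the language equations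
  of \<open>P\<close>; the derivable words form the least one.\<close>

lemma yields_in_substituted_lang:
  assumes "yields P \<alpha> w"
    and "\<And>A \<beta>. (A, \<beta>) \<in> P \<Longrightarrow> substituted_lang M \<beta> \<subseteq> M A"
  shows "w \<in> substituted_lang M \<alpha>"
  using assms(1)
proof (induction rule: yields.induct)
  case (yields_Nt A \<beta> u \<alpha> v)
  then have "u \<in> M A" using assms(2) by blast
  with yields_Nt.IH(2) show ?case by auto
qed auto

section \<open>Annotated grammars\<close>

text \<open>
  The relation \<open>tr k w y\<close> says that under the annotation \<open>k\<close> the word \<open>w\<close> may be rewritten to
  \<open>y\<close>; \<open>comp h g k\<close> says that words annotated \<open>h\<close> and \<open>g\<close> concatenate to one annotated \<open>k\<close>. In
  \<open>annotations_in\<close>, the words \<open>p\<close> and \<open>q\<close> witness that \<open>A\<close> is reachable from \<open>S\<close>; this is what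
  allows finitely many annotations to suffice.
\<close>

locale annotated_grammar =
  fixes P :: "('n, 't) prods" and S :: 'n
    and tr :: "'a \<Rightarrow> 't list \<Rightarrow> 's list \<Rightarrow> bool"
    and comp :: "'a \<Rightarrow> 'a \<Rightarrow> 'a \<Rightarrow> bool"
    and \<Phi> :: "('n \<times> 'a) set"
  assumes finite_prods: "finite P"
    and finite_annotations: "finite \<Phi>"
    and finite_unit: "finite {e. tr e [] []}"
    and finite_letter: "finite {(h, z). tr h [a] z}"
    and finite_comp: "finite {k. comp h g k}"
    and tr_Nil: "tr e [] y \<Longrightarrow> y = []"
    and tr_append: "comp h g k \<Longrightarrow> tr h u x \<Longrightarrow> tr g v y \<Longrightarrow> tr k (u @ v) (x @ y)"
    and tr_split: "tr k (u @ v) z \<Longrightarrow>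
          \<exists>h g x y. comp h g k \<and> tr h u x \<and> tr g v y \<and> z = x @ y"
    and annotations_in: "yields P [Nt A] w \<Longrightarrow> tr k w y \<Longrightarrow>
          (\<And>x. yields P [Nt A] x \<Longrightarrow> p @ x @ q \<in> grammar_lang P S) \<Longrightarrow> (A, k) \<in> \<Phi>"
begin

text \<open>The first component annotates the whole right-hand side; it is composed from the right
  end, starting at an annotation of the empty word. Letters are rewritten at once; annotated
  nonterminals are taken from \<open>\<Phi>\<close>, which leaves finitely many choices.\<close>

fun annotate :: "('n, 't) sym list \<Rightarrow> ('a \<times> ('n \<times> 'a, 's) sym list) set" where
  "annotate [] = {(e, []) | e. tr e [] []}"
| "annotate (Tm a # \<alpha>) =
     {(k, map Tm z @ \<beta>) | k h g z \<beta>. comp h g k \<and> tr h [a] z \<and> (g, \<beta>) \<in> annotate \<alpha>}"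
| "annotate (Nt A # \<alpha>) =
     {(k, Nt (A, h) # \<beta>) | k h g \<beta>. comp h g k \<and> (A, h) \<in> \<Phi> \<and> (g, \<beta>) \<in> annotate \<alpha>}"

definition annotated_prods :: "('n \<times> 'a, 's) prods" where
  "annotated_prods = {((A, k), \<beta>) | A k \<alpha> \<beta>. (A, \<alpha>) \<in> P \<and> (k, \<beta>) \<in> annotate \<alpha>}"

lemma finite_annotate: "finite (annotate \<alpha>)"
proof (induction \<alpha> rule: annotate.induct)
  case 1
  have "annotate [] = (\<lambda>e. (e, [])) ` {e. tr e [] []}" by auto
  then show ?case using finite_unit by simp
next
  case (2 a \<alpha>)
  have "annotate (Tm a # \<alpha>) \<subseteq> (\<Union>(h, z) \<in> {(h, z). tr h [a] z}. \<Union>(g, \<beta>) \<in> annotate \<alpha>.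
      (\<lambda>k. (k, map Tm z @ \<beta>)) ` {k. comp h g k})"
    by fastforce
  moreover have "finite \<dots>"
    using 2 by (auto intro!: finite_UN_I[OF finite_letter] finite_comp)
  ultimately show ?case by (rule finite_subset)
next
  case (3 A \<alpha>)
  have "annotate (Nt A # \<alpha>) \<subseteq> (\<Union>(B, h) \<in> \<Phi>. \<Union>(g, \<beta>) \<in> annotate \<alpha>.
      (\<lambda>k. (k, Nt (A, h) # \<beta>)) ` {k. comp h g k})"
    by fastforce
  moreover have "finite \<dots>"
    using 3 by (auto intro!: finite_UN_I[OF finite_annotations] finite_comp)
  ultimately show ?case by (rule finite_subset)
qed

lemma finite_annotated_prods: "finite annotated_prods"
proof -
  have "annotated_prods \<subseteq> (\<Union>(A, \<alpha>) \<in> P. (\<lambda>(k, \<beta>). ((A, k), \<beta>)) ` annotate \<alpha>)"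
    by (force simp: annotated_prods_def)
  moreover have "finite \<dots>"
    using finite_prods finite_annotate by auto
  ultimately show ?thesis by (rule finite_subset)
qed

text \<open>\<open>annotate\<close> composes annotations just as \<open>tr_append\<close> composes
  rewritings. Hence reading \<open>(A, h)\<close> as the set of rewritings under \<open>h\<close> of
  words from \<open>A\<close> is closed under \<open>annotated_prods\<close>.\<close>

lemma annotate_sound:
  assumes "(k, \<beta>) \<in> annotate \<alpha>"
    and "y \<in> substituted_lang (\<lambda>(A, h). {y. \<exists>w. yields P [Nt A] w \<and> tr h w y}) \<beta>"
  shows "\<exists>w. yields P \<alpha> w \<and> tr k w y"
  using assms
proof (induction \<alpha> arbitrary: k \<beta> y rule: annotate.induct)
  case 1
  then show ?case by (auto intro: yields_Nil)
next
  case (2 a \<alpha>)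
  then obtain h g z \<gamma> x where *: "comp h g k" "tr h [a] z" "(g, \<gamma>) \<in> annotate \<alpha>" "y = z @ x"
    "x \<in> substituted_lang (\<lambda>(A, h). {y. \<exists>w. yields P [Nt A] w \<and> tr h w y}) \<gamma>"
    by (auto simp: substituted_lang_terminals_append)
  with 2(1) obtain w where "yields P \<alpha> w" "tr g w x" by blast
  with * show ?case
    using tr_append[of h g k "[a]" z w x] by (auto intro: yields_Tm)
next
  case (3 A \<alpha>)
  then obtain h g \<gamma> u v x where *: "comp h g k" "(g, \<gamma>) \<in> annotate \<alpha>" "y = u @ x"
    "yields P [Nt A] v" "tr h v u"
    "x \<in> substituted_lang (\<lambda>(A, h). {y. \<exists>w. yields P [Nt A] w \<and> tr h w y}) \<gamma>"
    by auto
  with 3(1) obtain w where "yields P \<alpha> w" "tr g w x" by blast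
  with * show ?case
    using tr_append[of h g k v u w x] yields_append[of P "[Nt A]" v \<alpha> w] by auto
qed

lemma annotated_yields_sound:
  assumes "yields annotated_prods [Nt (A, k)] y"
  shows "\<exists>w. yields P [Nt A] w \<and> tr k w y"
proof -
  have "y \<in> substituted_lang (\<lambda>(A, h). {y. \<exists>w. yields P [Nt A] w \<and> tr h w y}) [Nt (A, k)]"
    using assms
  proof (rule yields_in_substituted_lang, safe)
    fix A k \<beta> y
    assume "((A, k), \<beta>) \<in> annotated_prods"
      and "y \<in> substituted_lang (\<lambda>(A, h). {y. \<exists>w. yields P [Nt A] w \<and> tr h w y}) \<beta>"
    then obtain \<alpha> w where "(A, \<alpha>) \<in> P" "yields P \<alpha> w" "tr k w y"
      unfolding annotated_prods_def using annotate_sound by blast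
    then show "\<exists>w. yields P [Nt A] w \<and> tr k w y"
      by (auto simp: yields_single_Nt_iff)
  qed
  then show ?thesis by auto
qed

text \<open>\<open>tr_split\<close> distributes the rewriting over the forest. The context
  \<open>p\<close>, \<open>q\<close> is carried along so that \<open>annotations_in\<close> applies
  at every nonterminal met.\<close>

lemma annotated_yields_complete:
  assumes "yields P \<alpha> w" and "tr k w y"
    and "\<And>x. yields P \<alpha> x \<Longrightarrow> p @ x @ q \<in> grammar_lang P S"
  shows "\<exists>\<beta>. (k, \<beta>) \<in> annotate \<alpha> \<and> yields annotated_prods \<beta> y"
  using assms
proof (induction arbitrary: k y p q rule: yields.induct)
  case yields_Nil
  then show ?case using tr_Nil by (auto intro: yields.yields_Nil)
next
  case (yields_Tm \<alpha> w a)
  from tr_split[of k "[a]" w y] yields_Tm.prems(1) obtain h g z x where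
    *: "comp h g k" "tr h [a] z" "tr g w x" "y = z @ x" by auto
  have "(p @ [a]) @ x @ q \<in> grammar_lang P S" if "yields P \<alpha> x" for x
    using yields_Tm.prems(2)[OF yields.yields_Tm[OF that]] by simp
  with yields_Tm.IH[OF *(3)] obtain \<beta> where
    "(g, \<beta>) \<in> annotate \<alpha>" "yields annotated_prods \<beta> x" by blast
  with * have "(k, map Tm z @ \<beta>) \<in> annotate (Tm a # \<alpha>)"
    and "yields annotated_prods (map Tm z @ \<beta>) y"
    by (fastforce, simp add: yields_append yields_terminals)
  then show ?case by blast
next
  case (yields_Nt A \<beta> u \<alpha> v)
  from tr_split[OF yields_Nt.prems(1)] obtain h g z x where
    *: "comp h g k" "tr h u z" "tr g v x" "y = z @ x" by auto
  \<comment> \<open>The yield \<open>v\<close> of the remaining symbols joins the right context of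
    \<open>A\<close>; dually, \<open>u\<close> joins the left context of \<open>\<alpha>\<close>
    below.\<close>
  have ctx: "p @ x @ (v @ q) \<in> grammar_lang P S" if "yields P [Nt A] x" for x
    using yields_Nt.prems(2)[of "x @ v"] yields_append[OF that yields_Nt.hyps(3)] by simp
  have A: "(A, h) \<in> \<Phi>"
    using yields_Nt.hyps(1,2) *(2) ctx
    by (intro annotations_in[of A u h z p "v @ q"]) (auto simp: yields_single_Nt_iff)
  have "p @ x @ (v @ q) \<in> grammar_lang P S" if "yields P \<beta> x" for x
    using ctx yields_Nt.hyps(1) that by (auto simp: yields_single_Nt_iff)
  from yields_Nt.IH(1)[OF *(2) this] obtain \<gamma> where
    \<gamma>: "(h, \<gamma>) \<in> annotate \<beta>" "yields annotated_prods \<gamma> z" by blast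
  have "(p @ u) @ x @ q \<in> grammar_lang P S" if "yields P \<alpha> x" for x
    using yields_Nt.prems(2)[OF yields.yields_Nt[OF yields_Nt.hyps(1,2) that]] by simp
  from yields_Nt.IH(2)[OF *(3) this] obtain \<delta> where
    \<delta>: "(g, \<delta>) \<in> annotate \<alpha>" "yields annotated_prods \<delta> x" by blast
  have "((A, h), \<gamma>) \<in> annotated_prods"
    using yields_Nt.hyps(1) \<gamma>(1) by (auto simp: annotated_prods_def)
  then have "yields annotated_prods (Nt (A, h) # \<delta>) y"
    using \<gamma>(2) \<delta>(2) *(4) by (auto intro: yields.yields_Nt)
  moreover have "(k, Nt (A, h) # \<delta>) \<in> annotate (Nt A # \<alpha>)"
    using * A \<delta> by auto
  ultimately show ?case by blast
qed

lemma context_free_lang_annotated: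
  "context_free_lang {y. \<exists>w \<in> grammar_lang P S. tr k w y}"
proof -
  have "yields annotated_prods [Nt (S, k)] y" if "yields P [Nt S] w" "tr k w y" for w y
  proof -
    from that(1) obtain \<alpha> where \<alpha>: "(S, \<alpha>) \<in> P" "yields P \<alpha> w"
      by (auto simp: yields_single_Nt_iff)
    have "[] @ x @ [] \<in> grammar_lang P S" if "yields P \<alpha> x" for x
      using \<alpha>(1) that by (auto simp: grammar_lang_eq_yields yields_single_Nt_iff)
    from annotated_yields_complete[OF \<alpha>(2) that(2) this] \<alpha>(1)
    show ?thesis
      unfolding yields_single_Nt_iff annotated_prods_def by blast
  qed
  then have "{y. \<exists>w \<in> grammar_lang P S. tr k w y} = grammar_lang annotated_prods (S, k)"
    using annotated_yields_sound by (auto simp: grammar_lang_eq_yields)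
  then show ?thesis
    using context_free_lang_grammar_lang[OF finite_annotated_prods] by simp
qed

end

section \<open>Left quotients by finite sets of words\<close>

text \<open>
  \<open>Across {[]}\<close> annotates the factors that lie entirely to the right of the cut. \<open>Across\<close> takes a
  set of prefixes so that the single annotation \<open>Across U\<close> of the start symbol yields the quotient
  by all of \<open>U\<close>.
\<close>

datatype 't cut = Inside "'t list" | Across "'t list set"

fun cut_tr :: "'t list set \<Rightarrow> 't cut \<Rightarrow> 't list \<Rightarrow> 't list \<Rightarrow> bool" where
  "cut_tr D (Inside d) w y \<longleftrightarrow> d \<in> D \<and> w = d \<and> y = []"
| "cut_tr D (Across X) w y \<longleftrightarrow> X \<subseteq> D \<and> (\<exists>d \<in> X. w = d @ y)"

text \<open>The cut lies beyond both factors, in the second, or in the first. In the second clause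
  \<open>Y\<close> may be larger than the set of all \<open>d @ x\<close>, so that a single
  remainder \<open>e\<close>, as \<open>Across {e}\<close>, fits below any \<open>Y\<close>
  containing \<open>d @ e\<close>.\<close>

fun cut_comp :: "'t list set \<Rightarrow> 't cut \<Rightarrow> 't cut \<Rightarrow> 't cut \<Rightarrow> bool" where
  "cut_comp D (Inside d) (Inside e) (Inside f) \<longleftrightarrow> f = d @ e \<and> f \<in> D"
| "cut_comp D (Inside d) (Across X) (Across Y) \<longleftrightarrow> Y \<subseteq> D \<and> (\<forall>x \<in> X. d @ x \<in> Y)"
| "cut_comp D (Across X) (Across Z) (Across Y) \<longleftrightarrow> X \<subseteq> D \<and> Z = {[]} \<and> Y = X"
| "cut_comp D _ _ _ \<longleftrightarrow> False"

lemma cut_tr_append: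
  assumes "cut_comp D h g k" "cut_tr D h u x" "cut_tr D g v y"
  shows "cut_tr D k (u @ v) (x @ y)"
  using assms by (cases "(D, h, g, k)" rule: cut_comp.cases) auto

text \<open>The erased prefix ends either inside \<open>u\<close> or inside \<open>v\<close>;
  closure of \<open>D\<close> under factors keeps both of its pieces in \<open>D\<close>.\<close>

lemma cut_tr_split:
  assumes D: "\<And>d e. d @ e \<in> D \<Longrightarrow> d \<in> D \<and> e \<in> D"
    and tr: "cut_tr D k (u @ v) z"
  shows "\<exists>h g x y. cut_comp D h g k \<and> cut_tr D h u x \<and> cut_tr D g v y \<and> z = x @ y"
proof (cases k)
  case (Inside d)
  then show ?thesis
    using tr D[of u v] by (intro exI[of _ "Inside u"] exI[of _ "Inside v"]) auto
next
  case (Across Y)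
  with tr obtain d where d: "Y \<subseteq> D" "d \<in> Y" "u @ v = d @ z" by auto
  then consider (left) e where "u = d @ e" "e @ v = z" | (right) e where "u @ e = d" "v = e @ z"
    by (auto simp: append_eq_append_conv2)
  then show ?thesis
  proof cases
    case left
    \<comment> \<open>Required by \<open>cut_tr\<close> for the annotation
      \<open>Across {[]}\<close> of \<open>v\<close>.\<close>
    have "[] \<in> D" using D[of d "[]"] d by auto
    with d left show ?thesis
      by (intro exI[of _ "Across Y"] exI[of _ "Across {[]}"] exI[of _ e] exI[of _ v])
        (auto simp: Across)
  next
    case right
    with d D[of u e] show ?thesis
      by (intro exI[of _ "Inside u"] exI[of _ "Across {e}"] exI[of _ "[]"] exI[of _ z])
        (auto simp: Across)
  qed
qed

lemma context_free_lang_left_quotient: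
  fixes L :: "'t list set"
  assumes "context_free_lang L" and "finite U"
  shows "context_free_lang {w. \<exists>u \<in> U. u @ w \<in> L}"
proof -
  obtain P :: "(nat, 't) prods" and S where P: "finite P" "L = grammar_lang P S"
    using assms(1) by (auto simp: context_free_lang_def)
  \<comment> \<open>Contiguous sublists: a subtree of the derivation can only erase a factor of some
    word of \<open>U\<close>.\<close>
  define D where "D = (\<Union>u \<in> U. set (sublists u))"
  define C where "C = Inside ` D \<union> Across ` Pow D"
  have C: "finite C"
    using assms(2) by (simp add: C_def D_def)
  have D: "d \<in> D \<and> e \<in> D" if "d @ e \<in> D" for d e
    using that sublist_order.order_trans[of d "d @ e"] sublist_order.order_trans[of e "d @ e"]
    by (auto simp: D_def)
  have tr_C: "k \<in> C" if "cut_tr D k w y" for k w y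
    using that by (cases k) (auto simp: C_def)
  have comp_C: "k \<in> C" if "cut_comp D h g k" for h g k
    using that by (cases "(D, h, g, k)" rule: cut_comp.cases) (auto simp: C_def)
  \<comment> \<open>The finite set \<open>C\<close> already bounds all annotations, so every
    nonterminal with a production is paired with all of \<open>C\<close>.\<close>
  interpret annotated_grammar P S "cut_tr D" "cut_comp D" "fst ` P \<times> C"
  proof
    show "finite {e. cut_tr D e [] []}"
      by (rule finite_subset[OF _ C]) (auto intro: tr_C)
    \<comment> \<open>A letter is either erased or kept.\<close>
    have "z \<in> {[], [a]}" if "cut_tr D h [a] z" for h a z
      using that by (cases h) (auto simp: Cons_eq_append_conv)
    then have "{(h, z). cut_tr D h [a] z} \<subseteq> C \<times> {[], [a]}" for a
      using tr_C by blast
    then show "finite {(h, z). cut_tr D h [a] z}" for a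
      by (rule finite_subset) (simp add: C)
    show "finite {k. cut_comp D h g k}" for h g
      by (rule finite_subset[OF _ C]) (auto intro: comp_C)
    show "y = []" if "cut_tr D e [] y" for e y
      using that by (cases e) auto
    show "(A, k) \<in> fst ` P \<times> C" if "yields P [Nt A] w" "cut_tr D k w y" for A w k y
      using that tr_C by (force simp: yields_single_Nt_iff)
    show "\<exists>h g x y. cut_comp D h g k \<and> cut_tr D h u x \<and> cut_tr D g v y \<and> z = x @ y"
      if "cut_tr D k (u @ v) z" for k u v z
      using D that by (rule cut_tr_split)
  qed (use P C in \<open>auto intro: cut_tr_append\<close>)
  have "U \<subseteq> D" by (auto simp: D_def)
  then have "{w. \<exists>u \<in> U. u @ w \<in> L} = {y. \<exists>w \<in> grammar_lang P S. cut_tr D (Across U) w y}"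
    by (auto simp: P(2))
  then show ?thesis
    by (simp only: context_free_lang_annotated)
qed

section \<open>Finite subgroups\<close>

context group
begin

lemma word_value_closed:
  "\<psi> \<in> \<Sigma> \<rightarrow> carrier G \<Longrightarrow> w \<in> lists \<Sigma> \<Longrightarrow> word_value G \<psi> w \<in> carrier G"
  by (induction w) (auto simp: word_value_def)

lemma word_value_append:
  "\<psi> \<in> \<Sigma> \<rightarrow> carrier G \<Longrightarrow> u \<in> lists \<Sigma> \<Longrightarrow> v \<in> lists \<Sigma> \<Longrightarrow>
   word_value G \<psi> (u @ v) = word_value G \<psi> u \<otimes> word_value G \<psi> v"
proof (induction u)
  case Nil
  then show ?case using word_value_closed[of \<psi> \<Sigma> v] by (simp add: word_value_def)
next
  case (Cons a u)
  have "word_value G \<psi> (b # w) = \<psi> b \<otimes> word_value G \<psi> w" for b w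
    by (simp add: word_value_def)
  with Cons show ?case
    using word_value_closed[OF \<open>\<psi> \<in> \<Sigma> \<rightarrow> carrier G\<close>] by (auto simp: m_assoc Pi_iff in_lists_conv_set)
qed

lemma context_free_lang_trivial_from_finite_subgroup:
  fixes \<psi> :: "'s \<Rightarrow> 'a"
  assumes \<psi>: "\<psi> \<in> \<Sigma> \<rightarrow> carrier G"
    and K: "subgroup K G" "finite K"
    and cf: "context_free_lang (subgroup_lang G K \<Sigma> \<psi>)"
  shows "context_free_lang (subgroup_lang G {\<one>} \<Sigma> \<psi>)"
proof -
  obtain P :: "(nat, 's) prods" and S where
    P: "finite P" "subgroup_lang G K \<Sigma> \<psi> = grammar_lang P S"
    using cf by (auto simp: context_free_lang_def)
  \<comment> \<open>One pair \<open>p\<close>, \<open>q\<close> has to serve all words derived from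
    \<open>A\<close>: this confines their values to a single two-sided translate of
    \<open>K\<close>.\<close>
  define reachable where "reachable A \<longleftrightarrow>
    (\<exists>p q. \<forall>x. yields P [Nt A] x \<longrightarrow> p @ x @ q \<in> grammar_lang P S)" for A
  define V where "V A = {word_value G \<psi> w | w. yields P [Nt A] w \<and> w \<in> lists \<Sigma>}" for A
  have finite_V: "finite (V A)" if "reachable A" for A
  proof -
    obtain p q where pq: "p @ x @ q \<in> subgroup_lang G K \<Sigma> \<psi>" if "yields P [Nt A] x" for x
      using \<open>reachable A\<close> P(2) by (auto simp: reachable_def)
    let ?p = "word_value G \<psi> p" and ?q = "word_value G \<psi> q"
    have "word_value G \<psi> w \<in> (\<lambda>k. inv ?p \<otimes> k \<otimes> inv ?q) ` K"
      if w: "yields P [Nt A] w" "w \<in> lists \<Sigma>" for w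
    proof -
      let ?w = "word_value G \<psi> w"
      have lists: "p \<in> lists \<Sigma>" "q \<in> lists \<Sigma>" and K: "word_value G \<psi> (p @ w @ q) \<in> K"
        using pq[OF w(1)] by (auto simp: subgroup_lang_def)
      note closed = word_value_closed[OF \<psi>]
      have "word_value G \<psi> (p @ w @ q) = ?p \<otimes> ?w \<otimes> ?q"
        using lists w(2) closed by (simp add: word_value_append[OF \<psi>] m_assoc)
      moreover have "?w = inv ?p \<otimes> (?p \<otimes> ?w \<otimes> ?q) \<otimes> inv ?q"
        using closed[OF lists(1)] closed[OF lists(2)] closed[OF w(2)]
        by (simp add: m_assoc r_inv) (simp add: m_assoc[symmetric])
      ultimately show ?thesis using K by (metis image_eqI)
    qed
    then have "V A \<subseteq> (\<lambda>k. inv ?p \<otimes> k \<otimes> inv ?q) ` K"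
      by (auto simp: V_def)
    then show ?thesis
      using K(2) finite_surj by blast
  qed
  \<comment> \<open>Words stay unchanged; the annotation only records their value, and composition
    is multiplication in \<open>G\<close>.\<close>
  define tr where "tr g w y \<longleftrightarrow> w \<in> lists \<Sigma> \<and> word_value G \<psi> w = g \<and> y = w" for g w y
  define comp where "comp h g k \<longleftrightarrow> k = h \<otimes> g" for h g k
  interpret annotated_grammar P S tr comp "SIGMA A:{A \<in> fst ` P. reachable A}. V A"
  proof
    show "finite (SIGMA A:{A \<in> fst ` P. reachable A}. V A)"
      using P(1) finite_V by auto
    have "{e. tr e [] []} \<subseteq> {\<one>}"
      by (auto simp: tr_def word_value_def)
    then show "finite {e. tr e [] []}"
      by (rule finite_subset) simp
    have "{(h, z). tr h [a] z} \<subseteq> {(word_value G \<psi> [a], [a])}" for a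
      by (auto simp: tr_def)
    then show "finite {(h, z). tr h [a] z}" for a
      by (rule finite_subset) simp
    show "tr k (u @ v) (x @ y)" if "comp h g k" "tr h u x" "tr g v y" for h g k u v x y
      using that word_value_append[OF \<psi>] by (auto simp: tr_def comp_def)
    show "\<exists>h g x y. comp h g k \<and> tr h u x \<and> tr g v y \<and> z = x @ y"
      if "tr k (u @ v) z" for k u v z
      using that word_value_append[OF \<psi>] by (auto simp: tr_def comp_def)
    show "(A, k) \<in> (SIGMA A:{A \<in> fst ` P. reachable A}. V A)"
      if "yields P [Nt A] w" "tr k w y"
        "\<And>x. yields P [Nt A] x \<Longrightarrow> p @ x @ q \<in> grammar_lang P S" for A w k y p q
    proof -
      have "reachable A" using that(3) unfolding reachable_def by blast
      moreover have "k \<in> V A" using that(1,2) by (auto simp: tr_def V_def)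
      moreover have "A \<in> fst ` P" using that(1) by (force simp: yields_single_Nt_iff)
      ultimately show ?thesis by simp
    qed
  qed (use P in \<open>auto simp: tr_def comp_def\<close>)
  \<comment> \<open>As \<open>\<one>\<close> lies in \<open>K\<close>, selecting the words of value
    \<open>\<one>\<close> from the language of \<open>K\<close> loses none of them.\<close>
  have "subgroup_lang G {\<one>} \<Sigma> \<psi> = {y. \<exists>w \<in> grammar_lang P S. tr \<one> w y}"
    using subgroup.one_closed[OF K(1)] by (auto simp: P(2)[symmetric] subgroup_lang_def tr_def)
  then show ?thesis
    by (simp only: context_free_lang_annotated)
qed

text \<open>A word has value \<open>k\<close> exactly when prefixing a word of value
  \<open>inv k\<close> gives \<open>\<one>\<close>. Choosing words for the inverses lets
  \<open>K\<close> be any finite subset.\<close>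

lemma context_free_lang_finite_subset_from_trivial:
  fixes \<psi> :: "'s \<Rightarrow> 'a"
  assumes \<psi>: "semigroup_presentation G \<Sigma> \<psi>"
    and K: "K \<subseteq> carrier G" "finite K"
    and cf: "context_free_lang (subgroup_lang G {\<one>} \<Sigma> \<psi>)"
  shows "context_free_lang (subgroup_lang G K \<Sigma> \<psi>)"
proof -
  have \<psi>': "\<psi> \<in> \<Sigma> \<rightarrow> carrier G" and surj: "word_value G \<psi> ` lists \<Sigma> = carrier G"
    using \<psi> by (auto simp: semigroup_presentation_def)
  have "\<exists>u \<in> lists \<Sigma>. word_value G \<psi> u = inv k" if "k \<in> K" for k
    using that K(1) surj by (metis imageE inv_closed subsetD)
  then obtain u where u: "u k \<in> lists \<Sigma>" "word_value G \<psi> (u k) = inv k" if "k \<in> K" for k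
    by metis
  have "u k @ w \<in> subgroup_lang G {\<one>} \<Sigma> \<psi> \<longleftrightarrow> w \<in> lists \<Sigma> \<and> word_value G \<psi> w = k"
    if "k \<in> K" for k w
  proof -
    have "inv k \<otimes> word_value G \<psi> w = \<one> \<longleftrightarrow> word_value G \<psi> w = k" if "w \<in> lists \<Sigma>"
      using word_value_closed[OF \<psi>' that] \<open>k \<in> K\<close> K(1)
      by (auto simp: inv_solve_left')
    then show ?thesis
      using u[OF that] word_value_append[OF \<psi>' u(1)[OF that], of w]
      by (cases "w \<in> lists \<Sigma>") (auto simp: subgroup_lang_def)
  qed
  then have "subgroup_lang G K \<Sigma> \<psi> = {w. \<exists>v \<in> u ` K. v @ w \<in> subgroup_lang G {\<one>} \<Sigma> \<psi>}"
    by (auto simp: subgroup_lang_def)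
  then show ?thesis
    using context_free_lang_left_quotient[OF cf finite_imageI[OF K(2)]] by simp
qed

end

theorem lemma4p13:
  fixes G :: "('g, 'm) monoid_scheme" and K :: "'g set"
  assumes "group G"
    and "finitely_generated G"
    and "subgroup K G"
    and "finite K"
  shows "context_free_pair G K \<longleftrightarrow> context_free_group G"
proof -
  interpret group G by (rule assms(1))
  \<comment> \<open>Both languages are compared over one presentation, so the existential witnesses
    carry over.\<close>
  have "context_free_lang (subgroup_lang G K \<Sigma> \<psi>) \<longleftrightarrow>
      context_free_lang (subgroup_lang G {\<one>\<^bsub>G\<^esub>} \<Sigma> \<psi>)"
    if "semigroup_presentation G \<Sigma> \<psi>" for \<Sigma> :: "nat set" and \<psi>
  proof
    have "\<psi> \<in> \<Sigma> \<rightarrow> carrier G"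
      using that by (simp add: semigroup_presentation_def)
    then show "context_free_lang (subgroup_lang G {\<one>\<^bsub>G\<^esub>} \<Sigma> \<psi>)"
      if "context_free_lang (subgroup_lang G K \<Sigma> \<psi>)"
      using context_free_lang_trivial_from_finite_subgroup[OF _ assms(3,4) that] by blast
    show "context_free_lang (subgroup_lang G K \<Sigma> \<psi>)"
      if "context_free_lang (subgroup_lang G {\<one>\<^bsub>G\<^esub>} \<Sigma> \<psi>)"
      by (rule context_free_lang_finite_subset_from_trivial
          [OF \<open>semigroup_presentation G \<Sigma> \<psi>\<close> subgroup.subset[OF assms(3)] assms(4) that])
  qed
  then show ?thesis
    unfolding context_free_group_def context_free_pair_def by blast
qed

end
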